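(* Let $t$ and $s$ be terms of the call-by-value $\lambda$-calculus with callcc and abort that contain no context variables. If $t\mathrel{\approx^t}s$, i.e. $(k\,t)\approx(k\,s)$ for a fresh context variable $k$, then $t$ and $s$ are contextually equivalent: for every context $C$ (a term of this calculus without context variables, with one hole) such that $C[t]$ and $C[s]$ have no free variables, the reduction of the program $C[t]$ terminates if and only if the reduction of the program $C[s]$ terminates.
   Context: Syntax of the original calculus: terms $t,s::=x\mid\lambda x.t\mid t\,s\mid\mathcal C\mid\mathcal A\,p$ with programs $p::=t$; values $v,w::=x\mid\lambda x.t\mid\mathcal C$ ($\mathcal C$ is callcc, $\mathcal A$ is abort); contexts $C$ are such terms with one hole, possibly under binders or under $\mathcal A$. Extended syntax with context variables $k$: programs $p,q::=t\mid k\,t$; evaluation contexts $E::=[\,]\mid v\,E\mid E\,t$; program contexts $F::=E\mid k\,E$; $F[t]$ is plugging. Terms modulo $\alpha$-conversion, capture-avoiding substitution $p\{v/x\}$. Reduction on programs: $F[(\lambda x.t)\,v]\to F[t\{v/x\}]$; $F[\mathcal C\,v]\to F[v\,(\lambda y.\mathcal A\,F[y])]$ with $y$ not free in $F$; $F[\mathcal A\,p]\to p$. $\to^*$ reflexive-transitive closure; $p\Downarrow q$ iff $p\to^*q$ with $q$ irreducible. Fresh means not occurring in the objects under consideration. For a relation $R$ on programs: $t\mathrel{R^t}s$ iff $(k\,t)\mathrel R(k\,s)$ for fresh $k$; $v\mathrel{R^v}w$ iff $(v\,x)\mathrel{R^t}(w\,x)$ for fresh $x$; $F\mathrel{R^E}F'$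 iff $F[x]\mathrel RF'[x]$ for fresh $x$; $F[x\,v]\mathrel{R^o}F'[x\,w]$ iff $F\mathrel{R^E}F'$ and $v\mathrel{R^v}w$. $R$ is a normal-form bisimulation if whenever $p\mathrel Rq$: (i) if $p\to p'$ then $q\to^*q'$ with $p'\mathrel Rq'$; (ii) if $p$ is a value then $q\Downarrow w$ for some value $w$; (iii) if $p=F[x\,v]$ then $q\Downarrow F'[x\,w]$ with $F[x\,v]\mathrel{R^o}F'[x\,w]$; (iv) if $p=k\,v$ then $q\Downarrow k\,w$ with $v\mathrel{R^v}w$; (v) the symmetric conditions with $p,q$ exchanged. Normal-form bisimilarity $\approx$ is the union of all normal-form bisimulations. *)

theory Defs
  imports Main
begin

text \<open>
  Terms modulo alpha-conversion are de Bruijn terms.  Variables are named by natural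
  numbers: in a term below \<open>n\<close> binders, index \<open>i < n\<close> is bound and index \<open>n + x\<close> is the
  free variable named \<open>x\<close>.  Context variables have no binder and are plain names.
  Values are a syntactic category of their own, embedded into terms by \<open>Val\<close>, so that
  evaluation contexts and substitution need no side conditions.
\<close>

datatype trm = Val val | App trm trm | Abort prog
  and val = Var nat | Lam trm | Callcc
  and prog = Term trm | CVar nat trm

primrec fv :: "trm \<Rightarrow> nat set" and fv_val :: "val \<Rightarrow> nat set" and fv_prog :: "prog \<Rightarrow> nat set" where
  "fv (Val v) = fv_val v"
| "fv (App t s) = fv t \<union> fv s"
| "fv (Abort p) = fv_prog p"
| "fv_val (Var x) = {x}"
| "fv_val (Lam t) = {x. Suc x \<in> fv t}"
| "fv_val Callcc = {}"
| "fv_prog (Term t) = fv t"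
| "fv_prog (CVar k t) = fv t"

primrec cv :: "trm \<Rightarrow> nat set" and cv_val :: "val \<Rightarrow> nat set" and cv_prog :: "prog \<Rightarrow> nat set" where
  "cv (Val v) = cv_val v"
| "cv (App t s) = cv t \<union> cv s"
| "cv (Abort p) = cv_prog p"
| "cv_val (Var x) = {}"
| "cv_val (Lam t) = cv t"
| "cv_val Callcc = {}"
| "cv_prog (Term t) = cv t"
| "cv_prog (CVar k t) = insert k (cv t)"


subsection \<open>Renaming and substitution\<close>

definition up_ren :: "(nat \<Rightarrow> nat) \<Rightarrow> nat \<Rightarrow> nat" where
  "up_ren r = case_nat 0 (\<lambda>x. Suc (r x))"

primrec ren :: "(nat \<Rightarrow> nat) \<Rightarrow> trm \<Rightarrow> trm"
  and ren_val :: "(nat \<Rightarrow> nat) \<Rightarrow> val \<Rightarrow> val"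
  and ren_prog :: "(nat \<Rightarrow> nat) \<Rightarrow> prog \<Rightarrow> prog" where
  "ren r (Val v) = Val (ren_val r v)"
| "ren r (App t s) = App (ren r t) (ren r s)"
| "ren r (Abort p) = Abort (ren_prog r p)"
| "ren_val r (Var x) = Var (r x)"
| "ren_val r (Lam t) = Lam (ren (up_ren r) t)"
| "ren_val r Callcc = Callcc"
| "ren_prog r (Term t) = Term (ren r t)"
| "ren_prog r (CVar k t) = CVar k (ren r t)"

definition up_subst :: "(nat \<Rightarrow> val) \<Rightarrow> nat \<Rightarrow> val" where
  "up_subst \<sigma> = case_nat (Var 0) (\<lambda>x. ren_val Suc (\<sigma> x))"

primrec subst :: "(nat \<Rightarrow> val) \<Rightarrow> trm \<Rightarrow> trm"
  and subst_val :: "(nat \<Rightarrow> val) \<Rightarrow> val \<Rightarrow> val"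
  and subst_prog :: "(nat \<Rightarrow> val) \<Rightarrow> prog \<Rightarrow> prog" where
  "subst \<sigma> (Val v) = Val (subst_val \<sigma> v)"
| "subst \<sigma> (App t s) = App (subst \<sigma> t) (subst \<sigma> s)"
| "subst \<sigma> (Abort p) = Abort (subst_prog \<sigma> p)"
| "subst_val \<sigma> (Var x) = \<sigma> x"
| "subst_val \<sigma> (Lam t) = Lam (subst (up_subst \<sigma>) t)"
| "subst_val \<sigma> Callcc = Callcc"
| "subst_prog \<sigma> (Term t) = Term (subst \<sigma> t)"
| "subst_prog \<sigma> (CVar k t) = CVar k (subst \<sigma> t)"

text \<open>For the body \<open>t\<close> of \<open>Lam t\<close>: replaces the bound index \<open>0\<close> and removes the binder.\<close>

definition inst :: "trm \<Rightarrow> val \<Rightarrow> trm" where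
  "inst t v = subst (case_nat v Var) t"


subsection \<open>Reduction\<close>

datatype ectx = Hole | ArgC val ectx | FunC ectx trm

datatype pctx = TermC ectx | CVarC nat ectx

primrec plug_e :: "ectx \<Rightarrow> trm \<Rightarrow> trm" where
  "plug_e Hole t = t"
| "plug_e (ArgC v E) t = App (Val v) (plug_e E t)"
| "plug_e (FunC E s) t = App (plug_e E t) s"

primrec plug :: "pctx \<Rightarrow> trm \<Rightarrow> prog" where
  "plug (TermC E) t = Term (plug_e E t)"
| "plug (CVarC k E) t = CVar k (plug_e E t)"

primrec fv_ectx :: "ectx \<Rightarrow> nat set" where
  "fv_ectx Hole = {}"
| "fv_ectx (ArgC v E) = fv_val v \<union> fv_ectx E"
| "fv_ectx (FunC E s) = fv_ectx E \<union> fv s"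

primrec fv_pctx :: "pctx \<Rightarrow> nat set" where
  "fv_pctx (TermC E) = fv_ectx E"
| "fv_pctx (CVarC k E) = fv_ectx E"

primrec ren_ectx :: "(nat \<Rightarrow> nat) \<Rightarrow> ectx \<Rightarrow> ectx" where
  "ren_ectx r Hole = Hole"
| "ren_ectx r (ArgC v E) = ArgC (ren_val r v) (ren_ectx r E)"
| "ren_ectx r (FunC E s) = FunC (ren_ectx r E) (ren r s)"

primrec ren_pctx :: "(nat \<Rightarrow> nat) \<Rightarrow> pctx \<Rightarrow> pctx" where
  "ren_pctx r (TermC E) = TermC (ren_ectx r E)"
| "ren_pctx r (CVarC k E) = CVarC k (ren_ectx r E)"

text \<open>
  In rule \<open>callcc\<close> the context is moved under the new binder, so its indices are shifted;
  this expresses that the bound variable is not free in \<open>F\<close>.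
\<close>

inductive step :: "prog \<Rightarrow> prog \<Rightarrow> bool" where
  beta: "step (plug F (App (Val (Lam t)) (Val v))) (plug F (inst t v))"
| callcc: "step (plug F (App (Val Callcc) (Val v)))
    (plug F (App (Val v) (Val (Lam (Abort (plug (ren_pctx Suc F) (Val (Var 0))))))))"
| abort: "step (plug F (Abort p)) p"

definition irreducible :: "prog \<Rightarrow> bool" where
  "irreducible p \<longleftrightarrow> (\<nexists>q. step p q)"

definition eval_to :: "prog \<Rightarrow> prog \<Rightarrow> bool" where
  "eval_to p q \<longleftrightarrow> step\<^sup>*\<^sup>* p q \<and> irreducible q"

definition terminates :: "prog \<Rightarrow> bool" where
  "terminates p \<longleftrightarrow> (\<exists>q. eval_to p q)"


subsection \<open>Normal-form bisimilarity\<close>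

abbreviation stuck :: "pctx \<Rightarrow> nat \<Rightarrow> val \<Rightarrow> prog" where
  "stuck F x v \<equiv> plug F (App (Val (Var x)) (Val v))"

text \<open>
  ``For fresh \<open>k\<close>'' is read as ``for some fresh \<open>k\<close>'', and likewise for variables.  As
  infinitely many names are fresh, this asks no more of a relation than the universal
  reading does.
\<close>

definition rel_trm :: "(prog \<Rightarrow> prog \<Rightarrow> bool) \<Rightarrow> trm \<Rightarrow> trm \<Rightarrow> bool" where
  "rel_trm R t s \<longleftrightarrow> (\<exists>k. k \<notin> cv t \<union> cv s \<and> R (CVar k t) (CVar k s))"

definition rel_val :: "(prog \<Rightarrow> prog \<Rightarrow> bool) \<Rightarrow> val \<Rightarrow> val \<Rightarrow> bool" where
  "rel_val R v w \<longleftrightarrow> (\<exists>x. x \<notin> fv_val v \<union> fv_val w \<and>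
     rel_trm R (App (Val v) (Val (Var x))) (App (Val w) (Val (Var x))))"

definition rel_ctx :: "(prog \<Rightarrow> prog \<Rightarrow> bool) \<Rightarrow> pctx \<Rightarrow> pctx \<Rightarrow> bool" where
  "rel_ctx R F F' \<longleftrightarrow> (\<exists>x. x \<notin> fv_pctx F \<union> fv_pctx F' \<and>
     R (plug F (Val (Var x))) (plug F' (Val (Var x))))"

definition rel_open :: "(prog \<Rightarrow> prog \<Rightarrow> bool) \<Rightarrow> prog \<Rightarrow> prog \<Rightarrow> bool" where
  "rel_open R p q \<longleftrightarrow> (\<exists>F F' x v w. p = stuck F x v \<and> q = stuck F' x w \<and>
     rel_ctx R F F' \<and> rel_val R v w)"

definition nf_sim :: "(prog \<Rightarrow> prog \<Rightarrow> bool) \<Rightarrow> bool" where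
  "nf_sim R \<longleftrightarrow> (\<forall>p q. R p q \<longrightarrow>
     (\<forall>p'. step p p' \<longrightarrow> (\<exists>q'. step\<^sup>*\<^sup>* q q' \<and> R p' q')) \<and>
     (\<forall>v. p = Term (Val v) \<longrightarrow> (\<exists>w. eval_to q (Term (Val w)))) \<and>
     (\<forall>F x v. p = stuck F x v \<longrightarrow>
        (\<exists>F' w. eval_to q (stuck F' x w) \<and> rel_open R (stuck F x v) (stuck F' x w))) \<and>
     (\<forall>k v. p = CVar k (Val v) \<longrightarrow>
        (\<exists>w. eval_to q (CVar k (Val w)) \<and> rel_val R v w)))"

definition nf_bisim :: "(prog \<Rightarrow> prog \<Rightarrow> bool) \<Rightarrow> bool" where
  "nf_bisim R \<longleftrightarrow> nf_sim R \<and> nf_sim (R\<inverse>\<inverse>)"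

definition nf_bisimilar :: "prog \<Rightarrow> prog \<Rightarrow> bool" where
  "nf_bisimilar p q \<longleftrightarrow> (\<exists>R. nf_bisim R \<and> R p q)"


subsection \<open>Contextual equivalence\<close>

text \<open>
  \<open>lam x t\<close> is abstraction over the free variable named \<open>x\<close>: that variable becomes index
  \<open>0\<close>, and the other free variables keep their names, hence are shifted.  Contexts are not
  taken modulo alpha-conversion; their binders are named, and plugging captures the free
  variables with these names.
\<close>

definition lam :: "nat \<Rightarrow> trm \<Rightarrow> val" where
  "lam x t = Lam (ren (\<lambda>y. if y = x then 0 else Suc y) t)"

datatype ctx = CHole | CLam nat ctx | CAppL ctx trm | CAppR trm ctx | CAbort ctx

primrec plug_ctx :: "ctx \<Rightarrow> trm \<Rightarrow> trm" where
  "plug_ctx CHole t = t"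
| "plug_ctx (CLam x C) t = Val (lam x (plug_ctx C t))"
| "plug_ctx (CAppL C s) t = App (plug_ctx C t) s"
| "plug_ctx (CAppR s C) t = App s (plug_ctx C t)"
| "plug_ctx (CAbort C) t = Abort (Term (plug_ctx C t))"

primrec cv_ctx :: "ctx \<Rightarrow> nat set" where
  "cv_ctx CHole = {}"
| "cv_ctx (CLam x C) = cv_ctx C"
| "cv_ctx (CAppL C s) = cv_ctx C \<union> cv s"
| "cv_ctx (CAppR s C) = cv s \<union> cv_ctx C"
| "cv_ctx (CAbort C) = cv_ctx C"

definition ctx_equiv :: "trm \<Rightarrow> trm \<Rightarrow> bool" where
  "ctx_equiv t s \<longleftrightarrow> (\<forall>C. cv_ctx C = {} \<and> fv (plug_ctx C t) = {} \<and> fv (plug_ctx C s) = {} \<longrightarrow>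
     (terminates (Term (plug_ctx C t)) \<longleftrightarrow> terminates (Term (plug_ctx C s))))"

end

theory Submission
  imports Defs
begin

text \<open>
  A context variable can be replaced by a program context just as a variable can be replaced
  by a value.  Close bisimilarity under simultaneous substitution of bisimilar values and
  program contexts that may themselves be such substitution instances.  The closure is a
  bisimulation: instances of a reducing pair reduce in lockstep, and when the substitution
  hits a stuck head variable \<open>x\<close> with substitute \<open>v\<close>, the configuration \<open>F[v u]\<close> is an
  instance of the program \<open>k (v z)\<close> on which the bisimilarity of the substitutes is tested.
  Hence bisimilarity is a congruence: plugging into \<open>F\<close> is the substitution \<open>k := F\<close>.
\<close>

section \<open>Simultaneous substitution for variables and context variables\<close>

text \<open>Substituting \<open>F\<close> for \<open>k\<close> turns the context \<open>k E\<close>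
  into \<open>F[E]\<close>, so program contexts must absorb evaluation contexts in their
  hole.\<close>

primrec comp_ectx :: "ectx \<Rightarrow> ectx \<Rightarrow> ectx" where
  "comp_ectx Hole E' = E'"
| "comp_ectx (ArgC v E) E' = ArgC v (comp_ectx E E')"
| "comp_ectx (FunC E s) E' = FunC (comp_ectx E E') s"

primrec comp_pctx :: "pctx \<Rightarrow> ectx \<Rightarrow> pctx" where
  "comp_pctx (TermC E) E' = TermC (comp_ectx E E')"
| "comp_pctx (CVarC k E) E' = CVarC k (comp_ectx E E')"

lemma plug_e_comp [simp]: "plug_e (comp_ectx E E') t = plug_e E (plug_e E' t)"
  by (induction E) auto

lemma plug_comp [simp]: "plug (comp_pctx F E) t = plug F (plug_e E t)"
  by (cases F) auto

lemma comp_ectx_Hole [simp]: "comp_ectx E Hole = E"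
  by (induction E) auto

lemma comp_pctx_Hole [simp]: "comp_pctx F Hole = F"
  by (cases F) auto

text \<open>Context variables have no binder, so passing under a lambda keeps every name
  \<open>k\<close> and only shifts the ordinary variables of the substituted contexts.\<close>

definition up_ksubst :: "(nat \<Rightarrow> pctx) \<Rightarrow> nat \<Rightarrow> pctx" where
  "up_ksubst \<kappa> k = ren_pctx Suc (\<kappa> k)"

primrec sub :: "(nat \<Rightarrow> val) \<Rightarrow> (nat \<Rightarrow> pctx) \<Rightarrow> trm \<Rightarrow> trm"
  and sub_val :: "(nat \<Rightarrow> val) \<Rightarrow> (nat \<Rightarrow> pctx) \<Rightarrow> val \<Rightarrow> val"
  and sub_prog :: "(nat \<Rightarrow> val) \<Rightarrow> (nat \<Rightarrow> pctx) \<Rightarrow> prog \<Rightarrow> prog" where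
  "sub \<sigma> \<kappa> (Val v) = Val (sub_val \<sigma> \<kappa> v)"
| "sub \<sigma> \<kappa> (App t s) = App (sub \<sigma> \<kappa> t) (sub \<sigma> \<kappa> s)"
| "sub \<sigma> \<kappa> (Abort p) = Abort (sub_prog \<sigma> \<kappa> p)"
| "sub_val \<sigma> \<kappa> (Var x) = \<sigma> x"
| "sub_val \<sigma> \<kappa> (Lam t) = Lam (sub (up_subst \<sigma>) (up_ksubst \<kappa>) t)"
| "sub_val \<sigma> \<kappa> Callcc = Callcc"
| "sub_prog \<sigma> \<kappa> (Term t) = Term (sub \<sigma> \<kappa> t)"
| "sub_prog \<sigma> \<kappa> (CVar k t) = plug (\<kappa> k) (sub \<sigma> \<kappa> t)"

primrec sub_ectx :: "(nat \<Rightarrow> val) \<Rightarrow> (nat \<Rightarrow> pctx) \<Rightarrow> ectx \<Rightarrow> ectx" where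
  "sub_ectx \<sigma> \<kappa> Hole = Hole"
| "sub_ectx \<sigma> \<kappa> (ArgC v E) = ArgC (sub_val \<sigma> \<kappa> v) (sub_ectx \<sigma> \<kappa> E)"
| "sub_ectx \<sigma> \<kappa> (FunC E s) = FunC (sub_ectx \<sigma> \<kappa> E) (sub \<sigma> \<kappa> s)"

primrec sub_pctx :: "(nat \<Rightarrow> val) \<Rightarrow> (nat \<Rightarrow> pctx) \<Rightarrow> pctx \<Rightarrow> pctx" where
  "sub_pctx \<sigma> \<kappa> (TermC E) = TermC (sub_ectx \<sigma> \<kappa> E)"
| "sub_pctx \<sigma> \<kappa> (CVarC k E) = comp_pctx (\<kappa> k) (sub_ectx \<sigma> \<kappa> E)"

abbreviation id_ksubst :: "nat \<Rightarrow> pctx" where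
  "id_ksubst \<equiv> \<lambda>k. CVarC k Hole"

lemma sub_plug_e [simp]: "sub \<sigma> \<kappa> (plug_e E t) = plug_e (sub_ectx \<sigma> \<kappa> E) (sub \<sigma> \<kappa> t)"
  by (induction E) auto

lemma sub_plug [simp]: "sub_prog \<sigma> \<kappa> (plug F t) = plug (sub_pctx \<sigma> \<kappa> F) (sub \<sigma> \<kappa> t)"
  by (cases F) auto

lemma ren_plug_e [simp]: "ren r (plug_e E t) = plug_e (ren_ectx r E) (ren r t)"
  by (induction E) auto

lemma ren_plug [simp]: "ren_prog r (plug F t) = plug (ren_pctx r F) (ren r t)"
  by (cases F) auto

lemma ren_comp_ectx [simp]:
  "ren_ectx r (comp_ectx E E') = comp_ectx (ren_ectx r E) (ren_ectx r E')"
  by (induction E) auto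

lemma ren_comp_pctx [simp]:
  "ren_pctx r (comp_pctx F E) = comp_pctx (ren_pctx r F) (ren_ectx r E)"
  by (cases F) auto

text \<open>Used to alter a substitution at a fresh name. Below a lambda both lifted substitutions
  fix index \<open>0\<close>, and the set of context variables is unchanged.\<close>

lemma sub_cong:
  "(\<And>x. x \<in> fv t \<Longrightarrow> \<sigma> x = \<sigma>' x) \<Longrightarrow> (\<And>k. k \<in> cv t \<Longrightarrow> \<kappa> k = \<kappa>' k) \<Longrightarrow>
    sub \<sigma> \<kappa> t = sub \<sigma>' \<kappa>' t"
  "(\<And>x. x \<in> fv_val v \<Longrightarrow> \<sigma> x = \<sigma>' x) \<Longrightarrow> (\<And>k. k \<in> cv_val v \<Longrightarrow> \<kappa> k = \<kappa>' k) \<Longrightarrow>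
    sub_val \<sigma> \<kappa> v = sub_val \<sigma>' \<kappa>' v"
  "(\<And>x. x \<in> fv_prog p \<Longrightarrow> \<sigma> x = \<sigma>' x) \<Longrightarrow> (\<And>k. k \<in> cv_prog p \<Longrightarrow> \<kappa> k = \<kappa>' k) \<Longrightarrow>
    sub_prog \<sigma> \<kappa> p = sub_prog \<sigma>' \<kappa>' p"
proof (induction t and v and p arbitrary: \<sigma> \<kappa> \<sigma>' \<kappa>' and \<sigma> \<kappa> \<sigma>' \<kappa>' and \<sigma> \<kappa> \<sigma>' \<kappa>')
  case (App t s)
  have "sub \<sigma> \<kappa> t = sub \<sigma>' \<kappa>' t" "sub \<sigma> \<kappa> s = sub \<sigma>' \<kappa>' s"
    by (rule App.IH; simp add: App.prems)+
  then show ?case by simp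
next
  case (Lam t)
  have "sub (up_subst \<sigma>) (up_ksubst \<kappa>) t = sub (up_subst \<sigma>') (up_ksubst \<kappa>') t"
    by (rule Lam.IH) (auto simp: up_subst_def up_ksubst_def Lam.prems split: nat.split)
  then show ?case by simp
next
  case (CVar k t)
  have "sub \<sigma> \<kappa> t = sub \<sigma>' \<kappa>' t"
    by (rule CVar.IH; simp add: CVar.prems)
  then show ?case by (simp add: CVar.prems)
next
  case (Val v)
  have "sub_val \<sigma> \<kappa> v = sub_val \<sigma>' \<kappa>' v"
    by (rule Val.IH; simp add: Val.prems)
  then show ?case by simp
next
  case (Abort p)
  have "sub_prog \<sigma> \<kappa> p = sub_prog \<sigma>' \<kappa>' p"
    by (rule Abort.IH; simp add: Abort.prems)
  then show ?case by simp
next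
  case (Term t)
  have "sub \<sigma> \<kappa> t = sub \<sigma>' \<kappa>' t"
    by (rule Term.IH; simp add: Term.prems)
  then show ?case by simp
qed simp_all

lemma sub_ectx_fresh: "x \<notin> fv_ectx E \<Longrightarrow> sub_ectx (\<sigma>(x := v)) \<kappa> E = sub_ectx \<sigma> \<kappa> E"
  by (induction E) (auto intro!: sub_cong)

lemma sub_pctx_fresh: "x \<notin> fv_pctx F \<Longrightarrow> sub_pctx (\<sigma>(x := v)) \<kappa> F = sub_pctx \<sigma> \<kappa> F"
  by (cases F) (auto simp: sub_ectx_fresh)

section \<open>Composition laws for renaming and substitution\<close>

lemma up_ren_comp: "up_ren r \<circ> up_ren r' = up_ren (r \<circ> r')"
  by (auto simp: up_ren_def fun_eq_iff split: nat.split)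

lemma ren_ren [simp]:
  "ren r (ren r' t) = ren (r \<circ> r') t"
  "ren_val r (ren_val r' v) = ren_val (r \<circ> r') v"
  "ren_prog r (ren_prog r' p) = ren_prog (r \<circ> r') p"
  by (induction t and v and p arbitrary: r r' and r r' and r r') (auto simp: up_ren_comp)

lemma ren_ren_ectx [simp]: "ren_ectx r (ren_ectx r' E) = ren_ectx (r \<circ> r') E"
  by (induction E) (auto simp: comp_def)

lemma ren_ren_pctx [simp]: "ren_pctx r (ren_pctx r' F) = ren_pctx (r \<circ> r') F"
  by (cases F) auto

lemma up_subst_up_ren: "up_subst \<sigma> \<circ> up_ren r = up_subst (\<sigma> \<circ> r)"
  by (auto simp: up_ren_def up_subst_def fun_eq_iff split: nat.split)

lemma sub_ren [simp]:
  "sub \<sigma> \<kappa> (ren r t) = sub (\<sigma> \<circ> r) \<kappa> t"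
  "sub_val \<sigma> \<kappa> (ren_val r v) = sub_val (\<sigma> \<circ> r) \<kappa> v"
  "sub_prog \<sigma> \<kappa> (ren_prog r p) = sub_prog (\<sigma> \<circ> r) \<kappa> p"
  by (induction t and v and p arbitrary: \<sigma> \<kappa> r and \<sigma> \<kappa> r and \<sigma> \<kappa> r)
    (auto simp: up_subst_up_ren)

lemma sub_ren_ectx [simp]: "sub_ectx \<sigma> \<kappa> (ren_ectx r E) = sub_ectx (\<sigma> \<circ> r) \<kappa> E"
  by (induction E) (auto simp: comp_def)

lemma sub_ren_pctx [simp]: "sub_pctx \<sigma> \<kappa> (ren_pctx r F) = sub_pctx (\<sigma> \<circ> r) \<kappa> F"
  by (cases F) auto

lemma up_ren_Suc: "up_ren r \<circ> Suc = Suc \<circ> r"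
  by (auto simp: up_ren_def)

lemma ren_up_subst: "ren_val (up_ren r) \<circ> up_subst \<sigma> = up_subst (ren_val r \<circ> \<sigma>)"
  by (rule ext) (auto simp: up_subst_def up_ren_Suc split: nat.split, simp add: up_ren_def)

lemma ren_up_ksubst: "ren_pctx (up_ren r) \<circ> up_ksubst \<kappa> = up_ksubst (ren_pctx r \<circ> \<kappa>)"
  by (rule ext) (auto simp: up_ksubst_def up_ren_Suc)

lemma ren_sub [simp]:
  "ren r (sub \<sigma> \<kappa> t) = sub (ren_val r \<circ> \<sigma>) (ren_pctx r \<circ> \<kappa>) t"
  "ren_val r (sub_val \<sigma> \<kappa> v) = sub_val (ren_val r \<circ> \<sigma>) (ren_pctx r \<circ> \<kappa>) v"
  "ren_prog r (sub_prog \<sigma> \<kappa> p) = sub_prog (ren_val r \<circ> \<sigma>) (ren_pctx r \<circ> \<kappa>) p"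
  by (induction t and v and p arbitrary: \<sigma> \<kappa> r and \<sigma> \<kappa> r and \<sigma> \<kappa> r)
    (auto simp: ren_up_subst ren_up_ksubst)

lemma ren_sub_ectx [simp]:
  "ren_ectx r (sub_ectx \<sigma> \<kappa> E) = sub_ectx (ren_val r \<circ> \<sigma>) (ren_pctx r \<circ> \<kappa>) E"
  by (induction E) (auto simp: comp_def)

lemma ren_sub_pctx [simp]:
  "ren_pctx r (sub_pctx \<sigma> \<kappa> F) = sub_pctx (ren_val r \<circ> \<sigma>) (ren_pctx r \<circ> \<kappa>) F"
  by (cases F) auto

lemma up_subst_Suc: "up_subst \<sigma> \<circ> Suc = ren_val Suc \<circ> \<sigma>"
  by (auto simp: up_subst_def)

lemma up_ksubst_eq: "up_ksubst \<kappa> = ren_pctx Suc \<circ> \<kappa>"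
  by (auto simp: up_ksubst_def)

lemma up_subst_comp:
  "sub_val (up_subst \<tau>) (up_ksubst \<rho>) \<circ> up_subst \<sigma> = up_subst (sub_val \<tau> \<rho> \<circ> \<sigma>)"
proof
  fix x
  show "(sub_val (up_subst \<tau>) (up_ksubst \<rho>) \<circ> up_subst \<sigma>) x = up_subst (sub_val \<tau> \<rho> \<circ> \<sigma>) x"
    by (cases x)
      (simp_all add: up_subst_def[of \<sigma>] up_subst_def[of "sub_val \<tau> \<rho> \<circ> \<sigma>"]
        up_subst_Suc up_ksubst_eq, simp add: up_subst_def)
qed

lemma up_ksubst_comp:
  "sub_pctx (up_subst \<tau>) (up_ksubst \<rho>) \<circ> up_ksubst \<kappa> = up_ksubst (sub_pctx \<tau> \<rho> \<circ> \<kappa>)"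
  by (rule ext)
    (simp add: up_ksubst_def[of \<kappa>] up_ksubst_def[of "sub_pctx \<tau> \<rho> \<circ> \<kappa>"]
      up_subst_Suc up_ksubst_eq[of \<rho>])

text \<open>Below a lambda the law requires that lifting commute with composition. This rests on
  \<open>sub_ren\<close> and \<open>ren_sub\<close>, which let a shift pass through a substitution;
  hence the laws for renamings come first.\<close>

lemma sub_sub [simp]:
  "sub \<tau> \<rho> (sub \<sigma> \<kappa> t) = sub (sub_val \<tau> \<rho> \<circ> \<sigma>) (sub_pctx \<tau> \<rho> \<circ> \<kappa>) t"
  "sub_val \<tau> \<rho> (sub_val \<sigma> \<kappa> v) = sub_val (sub_val \<tau> \<rho> \<circ> \<sigma>) (sub_pctx \<tau> \<rho> \<circ> \<kappa>) v"
  "sub_prog \<tau> \<rho> (sub_prog \<sigma> \<kappa> p) = sub_prog (sub_val \<tau> \<rho> \<circ> \<sigma>) (sub_pctx \<tau> \<rho> \<circ> \<kappa>) p"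
  by (induction t and v and p arbitrary: \<sigma> \<kappa> \<tau> \<rho> and \<sigma> \<kappa> \<tau> \<rho> and \<sigma> \<kappa> \<tau> \<rho>)
    (auto simp: up_subst_comp up_ksubst_comp)

lemma up_id_ksubst [simp]: "up_ksubst id_ksubst = id_ksubst"
  by (auto simp: up_ksubst_def)

lemma up_Var [simp]: "up_subst Var = Var"
  by (auto simp: up_subst_def split: nat.split)

lemma up_Var_comp: "up_subst (Var \<circ> r) = Var \<circ> up_ren r"
  by (auto simp: up_subst_def up_ren_def split: nat.split)

lemma sub_id [simp]:
  "sub Var id_ksubst t = t"
  "sub_val Var id_ksubst v = v"
  "sub_prog Var id_ksubst p = p"
  by (induction t and v and p) auto

lemma subst_eq_sub:
  "subst \<sigma> t = sub \<sigma> id_ksubst t"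
  "subst_val \<sigma> v = sub_val \<sigma> id_ksubst v"
  "subst_prog \<sigma> p = sub_prog \<sigma> id_ksubst p"
  by (induction t and v and p arbitrary: \<sigma> and \<sigma> and \<sigma>) auto

lemma ren_eq_sub:
  "ren r t = sub (Var \<circ> r) id_ksubst t"
  "ren_val r v = sub_val (Var \<circ> r) id_ksubst v"
  "ren_prog r p = sub_prog (Var \<circ> r) id_ksubst p"
  by (induction t and v and p arbitrary: r and r and r) (auto simp: up_Var_comp)

lemma sub_id_ectx [simp]: "sub_ectx Var id_ksubst E = E"
  by (induction E) auto

lemma sub_id_pctx [simp]: "sub_pctx Var id_ksubst F = F"
  by (cases F) auto

lemma sub_inst:
  "sub \<sigma> \<kappa> (inst t v) = inst (sub (up_subst \<sigma>) (up_ksubst \<kappa>) t) (sub_val \<sigma> \<kappa> v)"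
proof -
  \<comment> \<open>By \<open>sub_sub\<close> both sides are single substitutions, so it suffices to
    compare the composite maps. On the right, instantiation sends index \<open>0\<close> to the
    substituted value and undoes the shift that lifting performed.\<close>
  have "sub_val \<sigma> \<kappa> \<circ> case_nat v Var
      = sub_val (case_nat (sub_val \<sigma> \<kappa> v) Var) id_ksubst \<circ> up_subst \<sigma>"
    by (rule ext) (auto simp: up_subst_def comp_def split: nat.split)
  moreover have "sub_pctx \<sigma> \<kappa> \<circ> id_ksubst
      = sub_pctx (case_nat (sub_val \<sigma> \<kappa> v) Var) id_ksubst \<circ> up_ksubst \<kappa>"
    by (rule ext) (auto simp: up_ksubst_def comp_def)
  ultimately show ?thesis
    by (simp add: inst_def subst_eq_sub)
qed

text \<open>Every rule holds in an arbitrary program context, so \<open>F\<close> may simply become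
  \<open>sub_pctx \<sigma> \<kappa> F\<close>, even if that changes its outermost \<open>k\<close>.
  For callcc, the lifted substitution commutes with the shift of \<open>F\<close>.\<close>

lemma step_sub:
  assumes "step p q"
  shows "step (sub_prog \<sigma> \<kappa> p) (sub_prog \<sigma> \<kappa> q)"
  using assms
proof cases
  case (beta F t v)
  then show ?thesis by (simp add: sub_inst step.beta)
next
  case (callcc F v)
  then show ?thesis
    using step.callcc[of "sub_pctx \<sigma> \<kappa> F" "sub_val \<sigma> \<kappa> v"]
    by (simp add: up_subst_Suc up_ksubst_eq) (simp add: up_subst_def)
next
  case (abort F)
  then show ?thesis by (simp add: step.abort)
qed

lemma steps_sub: "step\<^sup>*\<^sup>* p q \<Longrightarrow> step\<^sup>*\<^sup>* (sub_prog \<sigma> \<kappa> p) (sub_prog \<sigma> \<kappa> q)"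
  by (induction rule: rtranclp_induct) (simp, meson step_sub rtranclp.rtrancl_into_rtrancl)

section \<open>Existence of fresh names\<close>

lemma finite_fv: "finite (fv t)" "finite (fv_val v)" "finite (fv_prog p)"
proof (induction t and v and p)
  \<comment> \<open>The free variables of \<open>Lam t\<close> are the preimage of those of
    \<open>t\<close> under the injective map \<open>Suc\<close>.\<close>
  case (Lam t)
  then show ?case
    using finite_vimageI[of "fv t" Suc] by (simp add: vimage_def)
qed auto

lemma finite_cv: "finite (cv t)" "finite (cv_val v)" "finite (cv_prog p)"
  by (induction t and v and p) auto

lemma finite_fv_ectx: "finite (fv_ectx E)"
  by (induction E) (auto simp: finite_fv)

lemma finite_fv_pctx: "finite (fv_pctx F)"
  by (cases F) (auto simp: finite_fv_ectx)

lemma ex_fresh: "finite A \<Longrightarrow> \<exists>x::nat. x \<notin> A"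
  by (rule ex_new_if_finite) simp_all


section \<open>Unique decomposition\<close>

text \<open>Redexes and stuck applications are covered together, so one unique decomposition result
  gives determinism, irreducibility of stuck programs and injectivity of
  \<open>stuck\<close>.\<close>

inductive is_focus :: "trm \<Rightarrow> bool" where
  "is_focus (App (Val v) (Val w))"
| "is_focus (Abort p)"

declare is_focus.intros [simp]

inductive_simps is_focus_simps [simp]: "is_focus (Val v)" "is_focus (App t s)"

lemma focus_not_Val [simp]:
  assumes "is_focus r"
  shows "plug_e E r \<noteq> Val v" and "Val v \<noteq> plug_e E r"
  using assms by (cases E; auto)+

lemma plug_focus_not_Val [simp]:
  assumes "is_focus r"
  shows "plug F r \<noteq> Term (Val v)" and "plug F r \<noteq> CVar k (Val v)"
    and "Term (Val v) \<noteq> plug F r" and "CVar k (Val v) \<noteq> plug F r"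
  using assms by (cases F; simp)+

text \<open>Apart from constructor clashes, two contexts that differ at their outermost layer would
  make a value equal to a plugged focus, which \<open>focus_not_Val\<close> excludes.\<close>

lemma plug_e_focus_inj:
  "plug_e E r = plug_e E' r' \<Longrightarrow> is_focus r \<Longrightarrow> is_focus r' \<Longrightarrow> E = E' \<and> r = r'"
proof (induction E arbitrary: E')
  case Hole
  then show ?case by (cases E') auto
next
  case (ArgC v E)
  then show ?case by (cases E') auto
next
  case (FunC E s)
  then show ?case by (cases E') auto
qed

lemma plug_focus_inj:
  "plug F r = plug F' r' \<Longrightarrow> is_focus r \<Longrightarrow> is_focus r' \<Longrightarrow> F = F' \<and> r = r'"
  by (cases F; cases F') (auto dest: plug_e_focus_inj)

lemma step_deterministic:
  assumes "step p q" and "step p q'"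
  shows "q = q'"
  using assms by (elim step.cases) (auto dest!: plug_focus_inj)

lemma stuck_inj: "stuck F x v = stuck F' x' v' \<Longrightarrow> F = F' \<and> x = x' \<and> v = v'"
  by (auto dest!: plug_focus_inj)

lemma not_step_stuck: "\<not> step (stuck F x v) q"
  by (auto elim!: step.cases dest!: plug_focus_inj)

lemma not_step_Term_Val: "\<not> step (Term (Val v)) q"
  by (auto elim!: step.cases)

lemma not_step_CVar_Val: "\<not> step (CVar k (Val v)) q"
  by (auto elim!: step.cases)

lemma trm_cases: "(\<exists>v. t = Val v) \<or> (\<exists>E r. t = plug_e E r \<and> is_focus r)"
proof (induction t rule: trm.induct[where ?P2.0 = "\<lambda>_. True" and ?P3.0 = "\<lambda>_. True"])
  case (App t s)
  show ?case
  proof (cases "\<exists>v. t = Val v")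
    case True
    then obtain v where t: "t = Val v" ..
    show ?thesis
    proof (cases "\<exists>w. s = Val w")
      case True
      then show ?thesis
        by (metis t plug_e.simps(1) is_focus.intros(1))
    next
      case False
      then show ?thesis
        by (metis App.IH(2) t plug_e.simps(2))
    qed
  next
    case False
    then show ?thesis
      by (metis App.IH(1) plug_e.simps(3))
  qed
next
  case (Abort p)
  then show ?case by (metis plug_e.simps(1) is_focus.intros(2))
qed auto

text \<open>The four cases match the four clauses of a normal-form simulation, so every later
  analysis of a program follows this split.\<close>

lemma prog_cases:
  obtains (step) q where "step p q"
  | (Term_Val) v where "p = Term (Val v)"
  | (CVar_Val) k v where "p = CVar k (Val v)"
  | (stuck) F x v where "p = stuck F x v"
proof -
  have "(\<exists>v. p = Term (Val v)) \<or> (\<exists>k v. p = CVar k (Val v)) \<or> (\<exists>F r. p = plug F r \<and> is_focus r)"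
  proof (cases p)
    case (Term t)
    then show ?thesis by (metis trm_cases plug.simps(1))
  next
    case (CVar k t)
    then show ?thesis by (metis trm_cases plug.simps(2))
  qed
  moreover have "(\<exists>q. step (plug F r) q) \<or> (\<exists>x v. plug F r = stuck F x v)" if "is_focus r" for F r
    using that
  proof cases
    case (1 v w)
    then show ?thesis by (cases v) (auto intro: step.intros)
  qed (auto intro: step.intros)
  ultimately show ?thesis
    using that by blast
qed


section \<open>Bisimilarity\<close>

text \<open>The clauses of \<open>nf_sim\<close> at a single pair, which allows induction on how
  that pair is related. Unique decomposition permits splitting \<open>rel_open\<close> into its two
  components.\<close>

definition sim_at :: "(prog \<Rightarrow> prog \<Rightarrow> bool) \<Rightarrow> prog \<Rightarrow> prog \<Rightarrow> bool" where
  "sim_at R p q \<longleftrightarrow>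
     (\<forall>p'. step p p' \<longrightarrow> (\<exists>q'. step\<^sup>*\<^sup>* q q' \<and> R p' q')) \<and>
     (\<forall>v. p = Term (Val v) \<longrightarrow> (\<exists>w. eval_to q (Term (Val w)))) \<and>
     (\<forall>F x v. p = stuck F x v \<longrightarrow>
        (\<exists>F' w. eval_to q (stuck F' x w) \<and> rel_ctx R F F' \<and> rel_val R v w)) \<and>
     (\<forall>k v. p = CVar k (Val v) \<longrightarrow>
        (\<exists>w. eval_to q (CVar k (Val w)) \<and> rel_val R v w))"

lemma rel_open_stuck:
  "rel_open R (stuck F x v) (stuck F' x w) \<longleftrightarrow> rel_ctx R F F' \<and> rel_val R v w"
  unfolding rel_open_def by (metis stuck_inj)

lemma nf_sim_iff: "nf_sim R \<longleftrightarrow> (\<forall>p q. R p q \<longrightarrow> sim_at R p q)"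
  unfolding nf_sim_def sim_at_def rel_open_stuck by blast

lemma rel_val_mono: "R \<le> S \<Longrightarrow> rel_val R v w \<Longrightarrow> rel_val S v w"
  unfolding rel_val_def rel_trm_def by blast

lemma rel_ctx_mono: "R \<le> S \<Longrightarrow> rel_ctx R F F' \<Longrightarrow> rel_ctx S F F'"
  unfolding rel_ctx_def by blast

lemma sim_at_mono:
  assumes "R \<le> S" and "sim_at R p q"
  shows "sim_at S p q"
  unfolding sim_at_def
proof (intro conjI allI impI)
  show "\<exists>q'. step\<^sup>*\<^sup>* q q' \<and> S p' q'" if "step p p'" for p'
    using assms that unfolding sim_at_def by blast
next
  show "\<exists>w. eval_to q (Term (Val w))" if "p = Term (Val v)" for v
    using assms(2) that unfolding sim_at_def by blast
next
  fix F x v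
  assume "p = stuck F x v"
  then obtain F' w where "eval_to q (stuck F' x w)" "rel_ctx R F F'" "rel_val R v w"
    using assms(2) unfolding sim_at_def by blast
  then show "\<exists>F' w. eval_to q (stuck F' x w) \<and> rel_ctx S F F' \<and> rel_val S v w"
    using rel_ctx_mono[OF assms(1)] rel_val_mono[OF assms(1)] by blast
next
  fix k v
  assume "p = CVar k (Val v)"
  then obtain w where "eval_to q (CVar k (Val w))" "rel_val R v w"
    using assms(2) unfolding sim_at_def by blast
  then show "\<exists>w. eval_to q (CVar k (Val w)) \<and> rel_val S v w"
    using rel_val_mono[OF assms(1)] by blast
qed

lemma nf_bisimilar_sym: "nf_bisimilar p q \<Longrightarrow> nf_bisimilar q p"
proof -
  assume "nf_bisimilar p q"
  then obtain R where "nf_bisim R" "R p q"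
    unfolding nf_bisimilar_def by blast
  then show ?thesis
    unfolding nf_bisimilar_def by (intro exI[of _ "R\<inverse>\<inverse>"]) (simp add: nf_bisim_def)
qed

lemma nf_bisimilar_sim_at: "nf_bisimilar p q \<Longrightarrow> sim_at nf_bisimilar p q"
proof -
  assume "nf_bisimilar p q"
  then obtain R where R: "nf_bisim R" "R p q"
    unfolding nf_bisimilar_def by blast
  have "nf_bisimilar p q" if "R p q" for p q
    unfolding nf_bisimilar_def using R(1) that by (intro exI conjI)
  then have "R \<le> nf_bisimilar"
    by (intro predicate2I)
  moreover have "sim_at R p q"
    using R unfolding nf_bisim_def nf_sim_iff by simp
  ultimately show ?thesis
    by (rule sim_at_mono)
qed

text \<open>A symmetric relation equals its converse, so the simulation clauses need checking in one
  direction only.\<close>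

lemma nf_bisimilarI:
  assumes "R p q" and "symp R" and "\<And>p q. R p q \<Longrightarrow> sim_at R p q"
  shows "nf_bisimilar p q"
proof -
  have "R\<inverse>\<inverse> = R"
    using assms(2) by (auto simp: fun_eq_iff symp_def)
  then show ?thesis
    using assms(1,3) unfolding nf_bisimilar_def nf_bisim_def nf_sim_iff
    by (intro exI[of _ R]) simp
qed

section \<open>Criteria for the simulation clauses at one pair\<close>

lemma irreducible_simps [simp]:
  "irreducible (Term (Val v))" "irreducible (CVar k (Val v))" "irreducible (stuck F x v)"
  by (auto simp: irreducible_def not_step_Term_Val not_step_CVar_Val not_step_stuck)

text \<open>By determinism a single matched step answers the first clause, and the other clauses are
  vacuous for a reducible left program.\<close>

lemma sim_at_step:
  assumes "step p p'" and "step\<^sup>*\<^sup>* q q'" and "R p' q'"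
  shows "sim_at R p q"
  unfolding sim_at_def
proof (intro conjI allI impI)
  show "\<exists>q'. step\<^sup>*\<^sup>* q q' \<and> R p'' q'" if "step p p''" for p''
    using assms step_deterministic[OF assms(1) that] by blast
qed (use assms(1) in \<open>simp_all add: not_step_stuck not_step_Term_Val not_step_CVar_Val\<close>)

lemma sim_at_Term_Val: "step\<^sup>*\<^sup>* q (Term (Val w)) \<Longrightarrow> sim_at R (Term (Val v)) q"
  unfolding sim_at_def eval_to_def
  by (auto simp: not_step_Term_Val)

lemma sim_at_CVar_Val:
  "step\<^sup>*\<^sup>* q (CVar k (Val w)) \<Longrightarrow> rel_val R v w \<Longrightarrow> sim_at R (CVar k (Val v)) q"
  unfolding sim_at_def eval_to_def
  by (auto simp: not_step_CVar_Val)

lemma sim_at_stuck: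
  assumes "step\<^sup>*\<^sup>* q (stuck F' x w)" and "rel_ctx R F F'" and "rel_val R v w"
  shows "sim_at R (stuck F x v) q"
  unfolding sim_at_def
proof (intro conjI allI impI)
  fix F0 x0 v0
  assume "stuck F x v = stuck F0 x0 v0"
  then have "F0 = F" "x0 = x" "v0 = v"
    by (auto dest: stuck_inj)
  moreover have "eval_to q (stuck F' x w)"
    using assms(1) by (simp add: eval_to_def)
  ultimately show "\<exists>F' w. eval_to q (stuck F' x0 w) \<and> rel_ctx R F0 F' \<and> rel_val R v0 w"
    using assms(2,3) by blast
qed (auto simp: not_step_stuck plug_focus_not_Val is_focus.intros)

text \<open>Each clause only asks what the right program can reach, so reductions may be prepended
  there. The left program is unaffected.\<close>

lemma sim_at_steps:
  assumes "sim_at R p q'" and "step\<^sup>*\<^sup>* q q'"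
  shows "sim_at R p q"
proof -
  have "step\<^sup>*\<^sup>* q r" if "step\<^sup>*\<^sup>* q' r" for r
    using assms(2) that by (rule rtranclp_trans)
  moreover from this have "eval_to q r" if "eval_to q' r" for r
    using that by (simp add: eval_to_def)
  ultimately show ?thesis
    using assms(1) unfolding sim_at_def by (elim conjE, intro conjI) blast+
qed

lemma nf_bisimilar_refl [simp]: "nf_bisimilar p p"
proof (rule nf_bisimilarI[where R = "(=)"])
  fix p q :: prog
  assume "p = q"
  have val: "rel_val (=) v v" for v
    unfolding rel_val_def rel_trm_def
    by (simp add: ex_fresh finite_fv) (metis ex_fresh finite_cv finite_Un)
  have "rel_ctx (=) F F" for F
    unfolding rel_ctx_def by (simp add: ex_fresh finite_fv_pctx)
  then show "sim_at (=) p q"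
    using val \<open>p = q\<close>
    by (cases p rule: prog_cases)
      (auto intro: sim_at_step sim_at_Term_Val sim_at_CVar_Val sim_at_stuck)
qed (auto simp: symp_def)

text \<open>Bisimilarity enlarged by all pairs that step to bisimilar programs is again a symmetric
  simulation: an added pair answers a step by a step.\<close>

lemma nf_bisimilar_step:
  assumes "step p p'" and "step q q'" and "nf_bisimilar p' q'"
  shows "nf_bisimilar p q"
proof (rule nf_bisimilarI)
  let ?R = "\<lambda>p q. nf_bisimilar p q \<or> (\<exists>p' q'. step p p' \<and> step q q' \<and> nf_bisimilar p' q')"
  show "?R p q" using assms by blast
  show "symp ?R" by (auto simp: symp_def dest: nf_bisimilar_sym)
  fix p q
  assume "?R p q"
  then show "sim_at ?R p q"
  proof
    assume "nf_bisimilar p q"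
    from nf_bisimilar_sim_at[OF this] show ?thesis
      by (rule sim_at_mono[rotated]) blast
  next
    assume "\<exists>p' q'. step p p' \<and> step q q' \<and> nf_bisimilar p' q'"
    then show ?thesis by (metis (no_types, lifting) sim_at_step r_into_rtranclp)
  qed
qed

lemma rel_val_sym: "symp R \<Longrightarrow> rel_val R v w \<Longrightarrow> rel_val R w v"
  unfolding rel_val_def rel_trm_def symp_def by (metis Un_commute)

lemma rel_ctx_sym: "symp R \<Longrightarrow> rel_ctx R F F' \<Longrightarrow> rel_ctx R F' F"
  unfolding rel_ctx_def symp_def by (metis Un_commute)

text \<open>The right program follows the left one to its normal form; there one of the value or
  stuck clauses supplies an evaluation of the right program.\<close>

lemma nf_bisimilar_terminates:
  assumes "nf_bisimilar p q" and "terminates p"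
  shows "terminates q"
proof -
  obtain p' where p': "step\<^sup>*\<^sup>* p p'" "irreducible p'"
    using assms(2) by (auto simp: terminates_def eval_to_def)
  have "\<exists>q'. step\<^sup>*\<^sup>* q q' \<and> nf_bisimilar p' q'"
    using p'(1)
  proof (induction rule: rtranclp_induct)
    case (step y z)
    then show ?case
      by (metis nf_bisimilar_sim_at sim_at_def rtranclp_trans)
  qed (use assms in blast)
  then obtain q' where q': "step\<^sup>*\<^sup>* q q'" "sim_at nf_bisimilar p' q'"
    using nf_bisimilar_sim_at by blast
  from q'(2) p'(2) have "\<exists>q''. eval_to q' q''"
    by (cases p' rule: prog_cases) (unfold sim_at_def irreducible_def, blast+)
  with q'(1) show ?thesis
    unfolding terminates_def eval_to_def by (meson rtranclp_trans)
qed


section \<open>Closure of bisimilarity under substitution\<close>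

text \<open>The two base rules supply the entries of the identity substitution. Nested instances are
  kept as derivations rather than merged, so that induction can descend to the entries of a
  substitution.\<close>

inductive cl_val :: "val \<Rightarrow> val \<Rightarrow> bool" and cl_ctx :: "pctx \<Rightarrow> pctx \<Rightarrow> bool" where
  cl_val_Var: "cl_val (Var x) (Var x)"
| cl_val_sub: "rel_val nf_bisimilar v w \<Longrightarrow> (\<And>x. cl_val (\<sigma> x) (\<sigma>' x)) \<Longrightarrow>
    (\<And>k. cl_ctx (\<kappa> k) (\<kappa>' k)) \<Longrightarrow> cl_val (sub_val \<sigma> \<kappa> v) (sub_val \<sigma>' \<kappa>' w)"
| cl_ctx_CVarC: "cl_ctx (CVarC k Hole) (CVarC k Hole)"
| cl_ctx_sub: "rel_ctx nf_bisimilar F F' \<Longrightarrow> (\<And>x. cl_val (\<sigma> x) (\<sigma>' x)) \<Longrightarrow>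
    (\<And>k. cl_ctx (\<kappa> k) (\<kappa>' k)) \<Longrightarrow> cl_ctx (sub_pctx \<sigma> \<kappa> F) (sub_pctx \<sigma>' \<kappa>' F')"

inductive cl_prog :: "prog \<Rightarrow> prog \<Rightarrow> bool" where
  cl_prog_sub: "nf_bisimilar p q \<Longrightarrow> (\<And>x. cl_val (\<sigma> x) (\<sigma>' x)) \<Longrightarrow>
    (\<And>k. cl_ctx (\<kappa> k) (\<kappa>' k)) \<Longrightarrow> cl_prog (sub_prog \<sigma> \<kappa> p) (sub_prog \<sigma>' \<kappa>' q)"

lemma symp_nf_bisimilar: "symp nf_bisimilar"
  by (simp add: symp_def nf_bisimilar_sym)

lemma cl_sym:
  "cl_val v w \<Longrightarrow> cl_val w v"
  "cl_ctx F F' \<Longrightarrow> cl_ctx F' F"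
proof (induction rule: cl_val_cl_ctx.inducts)
  case (cl_val_sub v w \<sigma> \<sigma>' \<kappa> \<kappa>')
  have "rel_val nf_bisimilar w v"
    using cl_val_sub(1) by (rule rel_val_sym[OF symp_nf_bisimilar])
  then show ?case
    using cl_val_sub by (intro cl_val_cl_ctx.cl_val_sub)
next
  case (cl_ctx_sub F F' \<sigma> \<sigma>' \<kappa> \<kappa>')
  have "rel_ctx nf_bisimilar F' F"
    using cl_ctx_sub(1) by (rule rel_ctx_sym[OF symp_nf_bisimilar])
  then show ?case
    using cl_ctx_sub by (intro cl_val_cl_ctx.cl_ctx_sub)
qed (rule cl_val_cl_ctx.intros)+

lemma symp_cl_prog: "symp cl_prog"
proof (rule sympI)
  fix p q
  assume "cl_prog p q"
  then show "cl_prog q p"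
  proof cases
    case (cl_prog_sub p' q' \<sigma> \<sigma>' \<kappa> \<kappa>')
    show ?thesis
      unfolding cl_prog_sub(1,2)
      using nf_bisimilar_sym[OF cl_prog_sub(3)] cl_sym(1)[OF cl_prog_sub(4)] cl_sym(2)[OF cl_prog_sub(5)]
      by (rule cl_prog.cl_prog_sub)
  qed
qed

text \<open>This is an instance of \<open>k x\<close> paired with itself, under
  \<open>k := F\<close> and \<open>x := v\<close>. Constant substitutions suffice because no other
  names occur.\<close>

lemma cl_prog_plug:
  assumes "cl_ctx F F'" and "cl_val v w"
  shows "cl_prog (plug F (Val v)) (plug F' (Val w))"
  using cl_prog_sub[OF nf_bisimilar_refl[of "CVar 0 (Val (Var 0))"],
      of "\<lambda>_. v" "\<lambda>_. w" "\<lambda>_. F" "\<lambda>_. F'"] assms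
  by simp

lemma cl_prog_plug_App:
  assumes "cl_ctx F F'" and "cl_val v w" and "cl_val u u'"
  shows "cl_prog (plug F (App (Val v) (Val u))) (plug F' (App (Val w) (Val u')))"
  using cl_prog_sub[OF nf_bisimilar_refl[of "CVar 0 (App (Val (Var 0)) (Val (Var 1)))"],
      of "case_nat v (\<lambda>_. u)" "case_nat w (\<lambda>_. u')" "\<lambda>_. F" "\<lambda>_. F'"] assms
  by (simp split: nat.split)

lemma cl_ctx_rel_ctx:
  assumes "cl_ctx F F'"
  shows "rel_ctx cl_prog F F'"
proof -
  obtain x where "x \<notin> fv_pctx F \<union> fv_pctx F'"
    using ex_fresh[of "fv_pctx F \<union> fv_pctx F'"] finite_fv_pctx by auto
  then show ?thesis
    unfolding rel_ctx_def using cl_prog_plug[OF assms cl_val_Var] by blast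
qed

lemma cl_val_rel_val:
  assumes "cl_val v w"
  shows "rel_val cl_prog v w"
proof -
  obtain x where x: "x \<notin> fv_val v \<union> fv_val w"
    using ex_fresh[of "fv_val v \<union> fv_val w"] finite_fv by auto
  obtain k where "k \<notin> cv_val v \<union> cv_val w"
    using ex_fresh[of "cv_val v \<union> cv_val w"] finite_cv by auto
  then have "rel_trm cl_prog (App (Val v) (Val (Var x))) (App (Val w) (Val (Var x)))"
    unfolding rel_trm_def
    using cl_prog_plug_App[OF cl_ctx_CVarC assms cl_val_Var, of k x] by (auto intro!: exI[of _ k])
  then show ?thesis
    unfolding rel_val_def using x by blast
qed

section \<open>The closure satisfies the simulation clauses\<close>

lemma sim_at_sub_step:
  assumes "nf_bisimilar p q" and "step p p'"
    and "\<And>x. cl_val (\<sigma> x) (\<sigma>' x)" and "\<And>k. cl_ctx (\<kappa> k) (\<kappa>' k)"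
  shows "sim_at cl_prog (sub_prog \<sigma> \<kappa> p) (sub_prog \<sigma>' \<kappa>' q)"
proof -
  obtain q' where "step\<^sup>*\<^sup>* q q'" "nf_bisimilar p' q'"
    using nf_bisimilar_sim_at[OF assms(1)] assms(2) unfolding sim_at_def by blast
  then show ?thesis
    using assms(2-) by (intro sim_at_step[OF step_sub steps_sub]) (auto intro: cl_prog_sub)
qed

text \<open>
  Replacing a stuck head variable performs no reduction, so the induction is on the
  derivation that relates the two head values: it only continues when the left one is
  again a variable, which the substitution one level deeper replaces.
\<close>

lemma sim_at_plug_App:
  assumes "cl_val v w" and "cl_ctx F F'" and "cl_val u u'"
  shows "sim_at cl_prog (plug F (App (Val v) (Val u))) (plug F' (App (Val w) (Val u')))"
  using assms
\<comment> \<open>The contexts and arguments are generalized because the right-hand ones change when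
  the induction hypothesis is applied. Nothing is proved about \<open>cl_ctx\<close> derivations,
  hence the trivial predicate.\<close>
proof (induction v w arbitrary: F F' u u' rule: cl_val_cl_ctx.inducts(1)[where ?P2.0 = "\<lambda>_ _. True"])
  case (cl_val_Var x)
  then show ?case
    by (intro sim_at_stuck[where F' = F' and w = u'] cl_ctx_rel_ctx cl_val_rel_val) auto
next
  case (cl_val_sub v w \<sigma> \<sigma>' \<kappa> \<kappa>')
  obtain z k where z: "z \<notin> fv_val v" "z \<notin> fv_val w"
    and k: "k \<notin> cv_val v" "k \<notin> cv_val w"
    and B: "nf_bisimilar (CVar k (App (Val v) (Val (Var z)))) (CVar k (App (Val w) (Val (Var z))))"
      (is "nf_bisimilar ?p ?q")
    using cl_val_sub.hyps(1) unfolding rel_val_def rel_trm_def by auto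
  \<comment> \<open>The test names \<open>z\<close> and \<open>k\<close> of \<open>rel_val\<close>
    receive the actual argument and context. Their freshness leaves the instances of
    \<open>v\<close> and \<open>w\<close> unchanged.\<close>
  let ?\<sigma> = "\<sigma>(z := u)" and ?\<sigma>' = "\<sigma>'(z := u')" and ?\<kappa> = "\<kappa>(k := F)" and ?\<kappa>' = "\<kappa>'(k := F')"
  have v: "sub_val ?\<sigma> ?\<kappa> v = sub_val \<sigma> \<kappa> v" and w: "sub_val ?\<sigma>' ?\<kappa>' w = sub_val \<sigma>' \<kappa>' w"
    using z k by (auto intro!: sub_cong)
  have \<sigma>: "cl_val (?\<sigma> x) (?\<sigma>' x)" for x
    using cl_val_sub by simp
  have \<kappa>: "cl_ctx (?\<kappa> k) (?\<kappa>' k)" for k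
    using cl_val_sub by simp
  have p: "plug F (App (Val (sub_val \<sigma> \<kappa> v)) (Val u)) = sub_prog ?\<sigma> ?\<kappa> ?p"
    and q: "plug F' (App (Val (sub_val \<sigma>' \<kappa>' w)) (Val u')) = sub_prog ?\<sigma>' ?\<kappa>' ?q"
    by (simp_all add: v w)
  show ?case
  proof (cases "\<exists>y. v = Var y")
    case True
    then obtain y where y: "v = Var y" ..
    \<comment> \<open>The test program is itself stuck, so bisimilarity makes the other one reach a
      stuck program with the same head \<open>y\<close>; the hypothesis for the entries at
      \<open>y\<close> then applies. Since \<open>z\<close> is fresh, \<open>y\<close> differs from
      \<open>z\<close> and these entries are the original ones.\<close>
    have "?p = stuck (CVarC k Hole) y (Var z)"
      by (simp add: y)
    then obtain F'' w'' where steps: "step\<^sup>*\<^sup>* ?q (stuck F'' y w'')"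
      and F'': "rel_ctx nf_bisimilar (CVarC k Hole) F''" and w'': "rel_val nf_bisimilar (Var z) w''"
      using nf_bisimilar_sim_at[OF B] unfolding sim_at_def eval_to_def by blast
    have "cl_ctx (sub_pctx ?\<sigma> ?\<kappa> (CVarC k Hole)) (sub_pctx ?\<sigma>' ?\<kappa>' F'')"
      using F'' \<sigma> \<kappa> by (rule cl_ctx_sub)
    moreover have "cl_val (sub_val ?\<sigma> ?\<kappa> (Var z)) (sub_val ?\<sigma>' ?\<kappa>' w'')"
      using w'' \<sigma> \<kappa> by (rule cl_val_cl_ctx.cl_val_sub)
    ultimately have "sim_at cl_prog (plug F (App (Val (\<sigma> y)) (Val u)))
        (plug (sub_pctx ?\<sigma>' ?\<kappa>' F'') (App (Val (\<sigma>' y)) (Val (sub_val ?\<sigma>' ?\<kappa>' w''))))"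
      using cl_val_sub.IH(1) by simp
    moreover have "step\<^sup>*\<^sup>* (sub_prog ?\<sigma>' ?\<kappa>' ?q) (sub_prog ?\<sigma>' ?\<kappa>' (stuck F'' y w''))"
      by (rule steps_sub[OF steps])
    ultimately show ?thesis
      unfolding q using z y by (auto elim: sim_at_steps)
  next
    case False
    have "\<exists>p'. step ?p p'"
    proof (cases v)
      case (Lam t)
      then show ?thesis
        using step.beta[of "CVarC k Hole" t "Var z"] by auto
    next
      case Callcc
      then show ?thesis
        using step.callcc[of "CVarC k Hole" "Var z"] by auto
    qed (use False in blast)
    then obtain p' where "step ?p p'" ..
    then show ?thesis
      unfolding p q by (rule sim_at_sub_step[OF B _ \<sigma> \<kappa>])
  qed
qed simp_all

text \<open>The case \<open>k v\<close> is left out because the substitute for \<open>k\<close>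
  takes over there, which calls for an induction on \<open>cl_ctx\<close>.\<close>

lemma sim_at_sub_not_CVar_Val:
  assumes B: "nf_bisimilar p q" and \<sigma>: "\<And>x. cl_val (\<sigma> x) (\<sigma>' x)" and \<kappa>: "\<And>k. cl_ctx (\<kappa> k) (\<kappa>' k)"
    and "\<nexists>k v. p = CVar k (Val v)"
  shows "sim_at cl_prog (sub_prog \<sigma> \<kappa> p) (sub_prog \<sigma>' \<kappa>' q)"
proof (cases p rule: prog_cases)
  case (step p')
  then show ?thesis by (rule sim_at_sub_step[OF B _ \<sigma> \<kappa>])
next
  case (Term_Val v)
  then obtain w where "step\<^sup>*\<^sup>* q (Term (Val w))"
    using nf_bisimilar_sim_at[OF B] unfolding sim_at_def eval_to_def by blast
  from steps_sub[OF this, of \<sigma>' \<kappa>'] show ?thesis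
    unfolding Term_Val by (auto intro: sim_at_Term_Val)
next
  case (stuck F x v)
  then obtain F' w where steps: "step\<^sup>*\<^sup>* q (stuck F' x w)"
    and "rel_ctx nf_bisimilar F F'" "rel_val nf_bisimilar v w"
    using nf_bisimilar_sim_at[OF B] unfolding sim_at_def eval_to_def by blast
  then have "sim_at cl_prog (sub_prog \<sigma> \<kappa> p) (sub_prog \<sigma>' \<kappa>' (stuck F' x w))"
    using \<sigma> \<kappa> by (auto simp: stuck intro!: sim_at_plug_App cl_ctx_sub cl_val_sub)
  then show ?thesis
    by (rule sim_at_steps[OF _ steps_sub[OF steps]])
qed (use assms in blast)

text \<open>The counterpart of \<open>sim_at_plug_App\<close> for context variables: replacing
  \<open>k\<close> in \<open>k u\<close> performs no reduction, so the induction descends to the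
  entry at \<open>k\<close> of the inner substitution.\<close>

lemma sim_at_plug:
  assumes "cl_ctx F F'" and "cl_val v w"
  shows "sim_at cl_prog (plug F (Val v)) (plug F' (Val w))"
  using assms
proof (induction F F' arbitrary: v w rule: cl_val_cl_ctx.inducts(2)[where ?P1.0 = "\<lambda>_ _. True"])
  case (cl_ctx_CVarC k)
  then show ?case
    by (auto intro: sim_at_CVar_Val cl_val_rel_val)
next
  case (cl_ctx_sub F F' \<sigma> \<sigma>' \<kappa> \<kappa>')
  obtain x where x: "x \<notin> fv_pctx F" "x \<notin> fv_pctx F'"
    and B: "nf_bisimilar (plug F (Val (Var x))) (plug F' (Val (Var x)))"
    using cl_ctx_sub.hyps(1) unfolding rel_ctx_def by auto
  \<comment> \<open>The plugged values replace the fresh variable \<open>x\<close> on which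
    \<open>rel_ctx\<close> tests the two contexts.\<close>
  let ?\<sigma> = "\<sigma>(x := v)" and ?\<sigma>' = "\<sigma>'(x := w)"
  have \<sigma>: "cl_val (?\<sigma> x) (?\<sigma>' x)" for x
    using cl_ctx_sub by simp
  have \<kappa>: "cl_ctx (\<kappa> k) (\<kappa>' k)" for k
    using cl_ctx_sub by blast
  have p: "plug (sub_pctx \<sigma> \<kappa> F) (Val v) = sub_prog ?\<sigma> \<kappa> (plug F (Val (Var x)))"
    and q: "plug (sub_pctx \<sigma>' \<kappa>' F') (Val w) = sub_prog ?\<sigma>' \<kappa>' (plug F' (Val (Var x)))"
    using x by (simp_all add: sub_pctx_fresh)
  show ?case
  proof (cases "\<exists>k u. plug F (Val (Var x)) = CVar k (Val u)")
    case True
    then obtain k u where u: "plug F (Val (Var x)) = CVar k (Val u)" by blast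
    then obtain u' where steps: "step\<^sup>*\<^sup>* (plug F' (Val (Var x))) (CVar k (Val u'))"
      and u': "rel_val nf_bisimilar u u'"
      using nf_bisimilar_sim_at[OF B] unfolding sim_at_def eval_to_def by blast
    have "cl_val (sub_val ?\<sigma> \<kappa> u) (sub_val ?\<sigma>' \<kappa>' u')"
      using u' \<sigma> \<kappa> by (rule cl_val_sub)
    then have "sim_at cl_prog (sub_prog ?\<sigma> \<kappa> (CVar k (Val u))) (sub_prog ?\<sigma>' \<kappa>' (CVar k (Val u')))"
      using cl_ctx_sub.IH(1) by simp
    then show ?thesis
      unfolding p q u by (rule sim_at_steps[OF _ steps_sub[OF steps]])
  next
    case False
    then show ?thesis
      unfolding p q by (rule sim_at_sub_not_CVar_Val[OF B \<sigma> \<kappa>])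
  qed
qed simp_all

lemma cl_prog_sim_at:
  assumes "cl_prog p q"
  shows "sim_at cl_prog p q"
  using assms
proof cases
  case (cl_prog_sub p' q' \<sigma> \<sigma>' \<kappa> \<kappa>')
  show ?thesis
  proof (cases "\<exists>k v. p' = CVar k (Val v)")
    case True
    then obtain k v where v: "p' = CVar k (Val v)" by blast
    then obtain w where steps: "step\<^sup>*\<^sup>* q' (CVar k (Val w))" and w: "rel_val nf_bisimilar v w"
      using nf_bisimilar_sim_at[OF cl_prog_sub(3)] unfolding sim_at_def eval_to_def by blast
    have "cl_val (sub_val \<sigma> \<kappa> v) (sub_val \<sigma>' \<kappa>' w)"
      using w cl_prog_sub(4,5) by (rule cl_val_sub)
    then have "sim_at cl_prog p (sub_prog \<sigma>' \<kappa>' (CVar k (Val w)))"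
      using cl_prog_sub(1,5) v by (simp add: sim_at_plug)
    then show ?thesis
      unfolding cl_prog_sub(2) by (rule sim_at_steps[OF _ steps_sub[OF steps]])
  next
    case False
    then show ?thesis
      unfolding cl_prog_sub(1,2) by (rule sim_at_sub_not_CVar_Val[OF cl_prog_sub(3-5)])
  qed
qed

theorem cl_prog_nf_bisimilar: "cl_prog p q \<Longrightarrow> nf_bisimilar p q"
  by (rule nf_bisimilarI[OF _ symp_cl_prog cl_prog_sim_at])


section \<open>Compatibility\<close>

text \<open>Equivalent to testing with one fresh \<open>k\<close>, but quantifying over all
  \<open>F\<close> lets surrounding syntax be absorbed into the context.\<close>

definition bisim_trm :: "trm \<Rightarrow> trm \<Rightarrow> bool" where
  "bisim_trm t s \<longleftrightarrow> (\<forall>F. nf_bisimilar (plug F t) (plug F s))"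

lemma cl_ctx_refl: "cl_ctx F F"
proof -
  have "rel_ctx nf_bisimilar F F"
    unfolding rel_ctx_def by (simp add: ex_fresh finite_fv_pctx)
  from cl_ctx_sub[OF this, of Var Var id_ksubst id_ksubst] show ?thesis
    by (simp add: cl_val_Var cl_ctx_CVarC)
qed

text \<open>Apply closure under substitution with \<open>k := F\<close> on the left and
  \<open>k := F'\<close> on the right. Allowing different contexts serves
  \<open>bisim_trm_AppR\<close>, and the renaming serves \<open>bisim_trm_ren\<close>.\<close>

lemma rel_trm_plug_sub:
  assumes "rel_trm nf_bisimilar t s" and "cl_ctx F F'"
  shows "nf_bisimilar (plug F (sub (Var \<circ> r) id_ksubst t)) (plug F' (sub (Var \<circ> r) id_ksubst s))"
proof -
  obtain k where k: "k \<notin> cv t" "k \<notin> cv s" and B: "nf_bisimilar (CVar k t) (CVar k s)"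
    using assms(1) unfolding rel_trm_def by auto
  have "cl_prog (sub_prog (Var \<circ> r) (id_ksubst(k := F)) (CVar k t))
      (sub_prog (Var \<circ> r) (id_ksubst(k := F')) (CVar k s))"
    by (rule cl_prog_sub[OF B]) (auto simp: assms(2) cl_val_Var cl_ctx_CVarC)
  moreover have "sub (Var \<circ> r) (id_ksubst(k := F)) t = sub (Var \<circ> r) id_ksubst t"
      "sub (Var \<circ> r) (id_ksubst(k := F')) s = sub (Var \<circ> r) id_ksubst s"
    using k by (auto intro!: sub_cong)
  ultimately show ?thesis
    by (simp add: cl_prog_nf_bisimilar)
qed

lemma bisim_trm_iff_rel_trm: "bisim_trm t s \<longleftrightarrow> rel_trm nf_bisimilar t s"
proof
  assume B: "bisim_trm t s"
  obtain k where "k \<notin> cv t \<union> cv s"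
    using ex_fresh[of "cv t \<union> cv s"] finite_cv by auto
  then show "rel_trm nf_bisimilar t s"
    using B[unfolded bisim_trm_def, rule_format, of "CVarC k Hole"] unfolding rel_trm_def by auto
next
  assume "rel_trm nf_bisimilar t s"
  then show "bisim_trm t s"
    unfolding bisim_trm_def
    using rel_trm_plug_sub[OF _ cl_ctx_refl, of t s _ id] by simp
qed

lemma bisim_trm_ren: "bisim_trm t s \<Longrightarrow> bisim_trm (ren r t) (ren r s)"
  using rel_trm_plug_sub[OF _ cl_ctx_refl, of t s _ r]
  by (simp add: bisim_trm_iff_rel_trm[symmetric] ren_eq_sub) (simp add: bisim_trm_def)

lemma bisim_trm_Val:
  assumes "rel_val nf_bisimilar v w"
  shows "bisim_trm (Val v) (Val w)"
proof -
  have "cl_val v w"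
    using cl_val_sub[OF assms, of Var Var id_ksubst id_ksubst]
    by (simp add: cl_val_Var cl_ctx_CVarC)
  then show ?thesis
    by (auto simp: bisim_trm_def intro: cl_prog_nf_bisimilar cl_prog_plug cl_ctx_refl)
qed

lemma bisim_trm_AppL:
  assumes "bisim_trm t s"
  shows "bisim_trm (App t u) (App s u)"
  unfolding bisim_trm_def
proof
  fix F
  show "nf_bisimilar (plug F (App t u)) (plug F (App s u))"
    using assms[unfolded bisim_trm_def, rule_format, of "comp_pctx F (FunC Hole u)"] by simp
qed

lemma bisim_trm_AppR:
  assumes "bisim_trm t s"
  shows "bisim_trm (App u t) (App u s)"
  unfolding bisim_trm_def
proof
  fix F
  \<comment> \<open>The operator \<open>u\<close> is evaluated first, so \<open>t\<close> and
    \<open>s\<close> sit unevaluated in the surrounding contexts. These are related because filling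
    the hole with a variable \<open>x\<close> puts \<open>t\<close> and \<open>s\<close> in the
    evaluation context \<open>F[x []]\<close>.\<close>
  let ?F = "\<lambda>t. comp_pctx F (FunC Hole t)"
  obtain x where "x \<notin> fv_pctx (?F t) \<union> fv_pctx (?F s)"
    using ex_fresh[of "fv_pctx (?F t) \<union> fv_pctx (?F s)"] finite_fv_pctx by auto
  moreover have "nf_bisimilar (plug (?F t) (Val (Var x))) (plug (?F s) (Val (Var x)))"
    using assms[unfolded bisim_trm_def, rule_format, of "comp_pctx F (ArgC (Var x) Hole)"] by simp
  ultimately have "rel_ctx nf_bisimilar (?F t) (?F s)"
    unfolding rel_ctx_def by blast
  from cl_ctx_sub[OF this, of Var Var id_ksubst id_ksubst]
  have "cl_ctx (?F t) (?F s)"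
    by (simp only: sub_id_pctx cl_val_Var cl_ctx_CVarC)
  moreover have "rel_trm nf_bisimilar u u"
    by (simp add: bisim_trm_iff_rel_trm[symmetric] bisim_trm_def)
  ultimately show "nf_bisimilar (plug F (App u t)) (plug F (App u s))"
    using rel_trm_plug_sub[of u u _ _ id] by fastforce
qed

text \<open>Abort discards \<open>F\<close> in one step on both sides, leaving the two terms in the
  empty context.\<close>

lemma bisim_trm_Abort: "bisim_trm t s \<Longrightarrow> bisim_trm (Abort (Term t)) (Abort (Term s))"
  unfolding bisim_trm_def
  by (metis nf_bisimilar_step plug.simps(1) plug_e.simps(1) step.abort)

text \<open>Applied to a fresh variable, both abstractions beta-reduce to renamings of their bodies,
  and \<open>bisim_trm\<close> is closed under renaming.\<close>

lemma bisim_trm_lam: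
  assumes "bisim_trm t s"
  shows "bisim_trm (Val (lam x t)) (Val (lam x s))"
proof (rule bisim_trm_Val)
  obtain z where z: "z \<notin> fv_val (lam x t) \<union> fv_val (lam x s)"
    using ex_fresh[of "fv_val (lam x t) \<union> fv_val (lam x s)"] finite_fv by auto
  \<comment> \<open>Instantiating by a variable is a renaming: \<open>case_nat z id\<close> sends
    the bound index to \<open>z\<close> and lowers the others by one.\<close>
  have inst: "inst (ren r u) (Var z) = ren (case_nat z id \<circ> r) u" for r u
  proof -
    have "case_nat (Var z) Var \<circ> r = Var \<circ> (case_nat z id \<circ> r)"
      by (auto split: nat.split)
    then show ?thesis by (simp add: inst_def subst_eq_sub ren_eq_sub(1)[of _ u] del: sub_ren)
        (simp add: comp_def)
  qed
  have "bisim_trm (App (Val (lam x t)) (Val (Var z))) (App (Val (lam x s)) (Val (Var z)))"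
    unfolding bisim_trm_def
  proof
    fix F
    show "nf_bisimilar (plug F (App (Val (lam x t)) (Val (Var z))))
        (plug F (App (Val (lam x s)) (Val (Var z))))"
      unfolding lam_def
      by (rule nf_bisimilar_step[OF step.beta step.beta])
        (use bisim_trm_ren[OF assms] in \<open>simp add: inst bisim_trm_def\<close>)
  qed
  then show "rel_val nf_bisimilar (lam x t) (lam x s)"
    unfolding rel_val_def bisim_trm_iff_rel_trm using z by blast
qed

lemma bisim_trm_plug_ctx: "bisim_trm t s \<Longrightarrow> bisim_trm (plug_ctx C t) (plug_ctx C s)"
  by (induction C) (auto intro: bisim_trm_lam bisim_trm_AppL bisim_trm_AppR bisim_trm_Abort)

theorem theorem5p9:
  fixes t s :: trm
  assumes "cv t = {}" and "cv s = {}"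
    and "rel_trm nf_bisimilar t s"
  shows "ctx_equiv t s"
proof -
  \<comment> \<open>The choice \<open>F = TermC Hole\<close> specializes compatibility to the whole
    programs.\<close>
  have "nf_bisimilar (Term (plug_ctx C t)) (Term (plug_ctx C s))" for C
    using bisim_trm_plug_ctx[of t s C] assms(3)
    unfolding bisim_trm_iff_rel_trm[symmetric] bisim_trm_def
    by (metis plug.simps(1) plug_e.simps(1))
  then show ?thesis
    unfolding ctx_equiv_def using nf_bisimilar_terminates nf_bisimilar_sym by blast
qed

end
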